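(* Let $FQ_n$ be the free quandle of rank $n\ge 1$. Then the integral quandle ring $\mathbb{Z}[FQ_n]$ has only trivial idempotents; that is, if $u\in\mathbb{Z}[FQ_n]$ is non-zero and $u^2=u$, then $u=e_x$ for some $x\in FQ_n$.
   Context: A quandle is a non-empty set $X$ with a binary operation $*$ such that, for each $y\in X$, the map $S_y:X\to X$, $S_y(x)=x*y$, is an automorphism of $(X,* )$ and $S_y(y)=y$. The free quandle $FQ_n$ of rank $n$ is the free object on $n$ generators in the category of quandles; equivalently, it is the free product of $n$ copies of the one-element quandle. The quandle ring $\mathbb{Z}[X]$ is the free $\mathbb{Z}$-module with basis $\{e_x\mid x\in X\}$ with the (in general non-associative) bilinear product determined by $e_xe_y=e_{x*y}$. An idempotent is a non-zero $u$ with $u^2=u$; the idempotents $e_x$ are called trivial. *)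

theory Defs
  imports Main "HOL-Library.FuncSet" "HOL-Library.Poly_Mapping"
begin

section \<open>Quandles\<close>

definition magma_hom ::
  "'a set \<Rightarrow> ('a \<Rightarrow> 'a \<Rightarrow> 'a) \<Rightarrow> 'b set \<Rightarrow> ('b \<Rightarrow> 'b \<Rightarrow> 'b) \<Rightarrow> ('a \<Rightarrow> 'b) \<Rightarrow> bool"
  where "magma_hom X f Y g h \<longleftrightarrow> h \<in> X \<rightarrow> Y \<and> (\<forall>a\<in>X. \<forall>b\<in>X. h (f a b) = g (h a) (h b))"

definition magma_aut :: "'a set \<Rightarrow> ('a \<Rightarrow> 'a \<Rightarrow> 'a) \<Rightarrow> ('a \<Rightarrow> 'a) \<Rightarrow> bool"
  where "magma_aut X f h \<longleftrightarrow> magma_hom X f X f h \<and> bij_betw h X X"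

locale quandle =
  fixes X :: "'a set" and qop :: "'a \<Rightarrow> 'a \<Rightarrow> 'a"  (infixl "\<rhd>" 70)
  assumes nonempty: "X \<noteq> {}"
    and closed: "\<lbrakk>x \<in> X; y \<in> X\<rbrakk> \<Longrightarrow> x \<rhd> y \<in> X"
    and right_mult_aut: "y \<in> X \<Longrightarrow> magma_aut X (\<rhd>) (\<lambda>x. x \<rhd> y)"
    and idem: "y \<in> X \<Longrightarrow> y \<rhd> y = y"


section \<open>Free quandles\<close>

text \<open>
  The free quandle on a set \<open>A\<close> is built as in universal algebra: terms in the generators,
  modulo the least congruence containing the quandle identities. Since the maps
  \<open>x \<mapsto> x * y\<close> of a quandle are bijective, the signature has a second operation \<open>QDiv\<close>, with
  \<open>QDiv x y\<close> standing for the unique \<open>z\<close> with \<open>z * y = x\<close>.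
\<close>

datatype 'g qterm = QGen 'g | QMul "'g qterm" "'g qterm" | QDiv "'g qterm" "'g qterm"

definition qterms :: "'g set \<Rightarrow> 'g qterm set"
  where "qterms A = {t. set_qterm t \<subseteq> A}"

inductive qcong :: "'g set \<Rightarrow> 'g qterm \<Rightarrow> 'g qterm \<Rightarrow> bool" for A :: "'g set" where
  refl: "x \<in> qterms A \<Longrightarrow> qcong A x x"
| sym: "qcong A x y \<Longrightarrow> qcong A y x"
| trans: "\<lbrakk>qcong A x y; qcong A y z\<rbrakk> \<Longrightarrow> qcong A x z"
| cong_mul: "\<lbrakk>qcong A x x'; qcong A y y'\<rbrakk> \<Longrightarrow> qcong A (QMul x y) (QMul x' y')"
| cong_div: "\<lbrakk>qcong A x x'; qcong A y y'\<rbrakk> \<Longrightarrow> qcong A (QDiv x y) (QDiv x' y')"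
| idem: "x \<in> qterms A \<Longrightarrow> qcong A (QMul x x) x"
| div_mul: "\<lbrakk>x \<in> qterms A; y \<in> qterms A\<rbrakk> \<Longrightarrow> qcong A (QMul (QDiv x y) y) x"
| mul_div: "\<lbrakk>x \<in> qterms A; y \<in> qterms A\<rbrakk> \<Longrightarrow> qcong A (QDiv (QMul x y) y) x"
| distrib: "\<lbrakk>x \<in> qterms A; y \<in> qterms A; z \<in> qterms A\<rbrakk>
    \<Longrightarrow> qcong A (QMul (QMul x y) z) (QMul (QMul x z) (QMul y z))"

definition qrel :: "'g set \<Rightarrow> ('g qterm \<times> 'g qterm) set"
  where "qrel A = {(s, t). qcong A s t}"

definition qclass :: "'g set \<Rightarrow> 'g qterm \<Rightarrow> 'g qterm set"
  where "qclass A t = qrel A `` {t}"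

definition free_quandle :: "'g set \<Rightarrow> 'g qterm set set"
  where "free_quandle A = qterms A // qrel A"

definition free_qop :: "'g set \<Rightarrow> 'g qterm set \<Rightarrow> 'g qterm set \<Rightarrow> 'g qterm set"
  where "free_qop A P Q = (\<Union>p\<in>P. \<Union>q\<in>Q. qclass A (QMul p q))"

definition free_gen :: "'g set \<Rightarrow> 'g \<Rightarrow> 'g qterm set"
  where "free_gen A a = qclass A (QGen a)"

definition FQ :: "nat \<Rightarrow> nat qterm set set"
  where "FQ n = free_quandle {..<n}"

definition FQ_op :: "nat \<Rightarrow> nat qterm set \<Rightarrow> nat qterm set \<Rightarrow> nat qterm set"
  where "FQ_op n = free_qop {..<n}"

lemma qterms_simps [simp]:
  "QGen a \<in> qterms A \<longleftrightarrow> a \<in> A"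
  "QMul x y \<in> qterms A \<longleftrightarrow> x \<in> qterms A \<and> y \<in> qterms A"
  "QDiv x y \<in> qterms A \<longleftrightarrow> x \<in> qterms A \<and> y \<in> qterms A"
  by (auto simp: qterms_def)

lemma qcong_qterms: "qcong A x y \<Longrightarrow> x \<in> qterms A \<and> y \<in> qterms A"
  by (induction rule: qcong.induct) auto

lemma equiv_qrel: "equiv (qterms A) (qrel A)"
  by (rule equivI)
    (auto simp: qrel_def refl_on_def sym_def trans_def dest: qcong_qterms
      intro: qcong.refl qcong.sym qcong.trans)

lemma qclass_eq_iff:
  "\<lbrakk>s \<in> qterms A; t \<in> qterms A\<rbrakk> \<Longrightarrow> qclass A s = qclass A t \<longleftrightarrow> qcong A s t"
  using eq_equiv_class_iff[OF equiv_qrel] by (fastforce simp: qclass_def qrel_def)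

lemma qclass_eqI: "qcong A s t \<Longrightarrow> qclass A s = qclass A t"
  using qclass_eq_iff qcong_qterms by blast

lemma free_quandleE:
  assumes "P \<in> free_quandle A"
  obtains t where "t \<in> qterms A" "P = qclass A t"
  using assms by (auto simp: free_quandle_def qclass_def elim: quotientE)

lemma qclass_in_free_quandle: "t \<in> qterms A \<Longrightarrow> qclass A t \<in> free_quandle A"
  by (simp add: free_quandle_def qclass_def quotientI)

lemma free_qop_class:
  assumes "s \<in> qterms A" "t \<in> qterms A"
  shows "free_qop A (qclass A s) (qclass A t) = qclass A (QMul s t)"
proof -
  have "(\<lambda>p q. qclass A (QMul p q)) respects2 qrel A"
    unfolding congruent2_def
    by (auto simp: qrel_def intro!: qclass_eqI qcong.cong_mul)
  from UN_equiv_class2[OF equiv_qrel equiv_qrel this assms] show ?thesis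
    by (simp add: free_qop_def qclass_def)
qed

lemma quandle_free_quandle:
  assumes "A \<noteq> {}"
  shows "quandle (free_quandle A) (free_qop A)"
proof
  obtain a where "a \<in> A" using assms by blast
  then have "qclass A (QGen a) \<in> free_quandle A" by (simp add: qclass_in_free_quandle)
  then show "free_quandle A \<noteq> {}" by blast
next
  fix P Q assume "P \<in> free_quandle A" "Q \<in> free_quandle A"
  then show "free_qop A P Q \<in> free_quandle A"
    by (auto elim!: free_quandleE simp: free_qop_class qclass_in_free_quandle)
next
  fix P assume "P \<in> free_quandle A"
  then show "free_qop A P P = P"
    by (elim free_quandleE) (simp add: free_qop_class qclass_eq_iff qcong.idem)
next
  fix Q assume "Q \<in> free_quandle A"
  then obtain t where t: "t \<in> qterms A" "Q = qclass A t" by (rule free_quandleE)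
  show "magma_aut (free_quandle A) (free_qop A) (\<lambda>P. free_qop A P Q)"
    unfolding magma_aut_def magma_hom_def
  proof (intro conjI ballI)
    show "(\<lambda>P. free_qop A P Q) \<in> free_quandle A \<rightarrow> free_quandle A"
      using t by (auto elim!: free_quandleE simp: free_qop_class qclass_in_free_quandle)
  next
    fix P R assume "P \<in> free_quandle A" "R \<in> free_quandle A"
    then show "free_qop A (free_qop A P R) Q = free_qop A (free_qop A P Q) (free_qop A R Q)"
      using t by (elim free_quandleE) (simp add: free_qop_class qclass_eq_iff qcong.distrib)
  next
    have inj: "qcong A r s"
      if "r \<in> qterms A" "s \<in> qterms A" "qcong A (QMul r t) (QMul s t)" for r s
    proof -
      have "qcong A (QDiv (QMul r t) t) (QDiv (QMul s t) t)"
        using that t by (intro qcong.cong_div qcong.refl)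
      then show ?thesis
        using that t by (meson qcong.mul_div qcong.sym qcong.trans)
    qed
    show "bij_betw (\<lambda>P. free_qop A P Q) (free_quandle A) (free_quandle A)"
      unfolding bij_betw_def
    proof (intro conjI subset_antisym)
      show "inj_on (\<lambda>P. free_qop A P Q) (free_quandle A)"
        using t inj by (auto elim!: free_quandleE intro!: inj_onI qclass_eqI
            simp: free_qop_class qclass_eq_iff)
      show "(\<lambda>P. free_qop A P Q) ` free_quandle A \<subseteq> free_quandle A"
        using t by (auto elim!: free_quandleE simp: free_qop_class qclass_in_free_quandle)
      show "free_quandle A \<subseteq> (\<lambda>P. free_qop A P Q) ` free_quandle A"
      proof
        fix P assume "P \<in> free_quandle A"
        then obtain s where s: "s \<in> qterms A" "P = qclass A s" by (rule free_quandleE)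
        have "P = free_qop A (qclass A (QDiv s t)) Q"
          using s t by (simp add: free_qop_class qclass_eq_iff qcong.div_mul qcong.sym)
        then show "P \<in> (\<lambda>P. free_qop A P Q) ` free_quandle A"
          using s t by (intro image_eqI[of _ _ "qclass A (QDiv s t)"]) (auto intro: qclass_in_free_quandle)
      qed
    qed
  qed
qed

primrec qeval :: "'b set \<Rightarrow> ('b \<Rightarrow> 'b \<Rightarrow> 'b) \<Rightarrow> ('g \<Rightarrow> 'b) \<Rightarrow> 'g qterm \<Rightarrow> 'b" where
  "qeval Y g \<phi> (QGen a) = \<phi> a"
| "qeval Y g \<phi> (QMul s t) = g (qeval Y g \<phi> s) (qeval Y g \<phi> t)"
| "qeval Y g \<phi> (QDiv s t) = inv_into Y (\<lambda>x. g x (qeval Y g \<phi> t)) (qeval Y g \<phi> s)"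

context quandle begin

lemma bij_right: "y \<in> X \<Longrightarrow> bij_betw (\<lambda>x. x \<rhd> y) X X"
  using right_mult_aut by (simp add: magma_aut_def)

lemma rdistrib: "\<lbrakk>x \<in> X; y \<in> X; z \<in> X\<rbrakk> \<Longrightarrow> (x \<rhd> y) \<rhd> z = (x \<rhd> z) \<rhd> (y \<rhd> z)"
  using right_mult_aut[of z] by (simp add: magma_aut_def magma_hom_def)

lemma rdiv_closed: "\<lbrakk>x \<in> X; y \<in> X\<rbrakk> \<Longrightarrow> inv_into X (\<lambda>z. z \<rhd> y) x \<in> X"
  using bij_right[of y] by (metis bij_betw_imp_surj_on inv_into_into)

lemma rdiv_mult: "\<lbrakk>x \<in> X; y \<in> X\<rbrakk> \<Longrightarrow> inv_into X (\<lambda>z. z \<rhd> y) x \<rhd> y = x"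
  using bij_betw_inv_into_right[OF bij_right, of y x] by simp

lemma mult_rdiv: "\<lbrakk>x \<in> X; y \<in> X\<rbrakk> \<Longrightarrow> inv_into X (\<lambda>z. z \<rhd> y) (x \<rhd> y) = x"
  using bij_betw_inv_into_left[OF bij_right, of y x] by simp

lemma qeval_closed:
  assumes "\<phi> \<in> A \<rightarrow> X" "t \<in> qterms A"
  shows "qeval X (\<rhd>) \<phi> t \<in> X"
  using assms(2) by (induction t) (use assms(1) in \<open>auto intro: closed rdiv_closed\<close>)

lemma qeval_cong:
  assumes "\<phi> \<in> A \<rightarrow> X" "qcong A s t"
  shows "qeval X (\<rhd>) \<phi> s = qeval X (\<rhd>) \<phi> t"
  using assms(2)
proof (induction rule: qcong.induct)
  case (distrib x y z)
  then show ?case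
    unfolding qeval.simps by (intro rdistrib qeval_closed[OF assms(1)])
qed (simp_all add: qeval_closed[OF assms(1)] idem rdiv_mult mult_rdiv)

text \<open>The universal property of the free quandle on \<open>A\<close>.\<close>

theorem free_quandle_universal:
  assumes "\<phi> \<in> A \<rightarrow> X"
  shows "\<exists>h. magma_hom (free_quandle A) (free_qop A) X (\<rhd>) h
               \<and> (\<forall>a\<in>A. h (free_gen A a) = \<phi> a)"
proof -
  define h where "h P = qeval X (\<rhd>) \<phi> (SOME t. t \<in> P)" for P
  have h: "h (qclass A t) = qeval X (\<rhd>) \<phi> t" if "t \<in> qterms A" for t
  proof -
    have "(SOME s. s \<in> qclass A t) \<in> qclass A t"
      using that by (simp add: some_in_eq) (auto simp: qclass_def qrel_def intro: qcong.refl)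
    then have "qcong A t (SOME s. s \<in> qclass A t)" by (simp add: qclass_def qrel_def)
    then show ?thesis using qeval_cong[OF assms] by (simp add: h_def)
  qed
  have "magma_hom (free_quandle A) (free_qop A) X (\<rhd>) h"
    unfolding magma_hom_def
    by (auto elim!: free_quandleE simp: free_qop_class h qeval_closed[OF assms])
  moreover have "\<forall>a\<in>A. h (free_gen A a) = \<phi> a"
    by (simp add: free_gen_def h)
  ultimately show ?thesis by blast
qed

theorem free_quandle_universal_unique:
  assumes h: "magma_hom (free_quandle A) (free_qop A) X (\<rhd>) h"
    and k: "magma_hom (free_quandle A) (free_qop A) X (\<rhd>) k"
    and gen: "\<forall>a\<in>A. h (free_gen A a) = k (free_gen A a)"
    and P: "P \<in> free_quandle A"
  shows "h P = k P"
proof -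
  have cl: "f (qclass A s) \<in> X"
    if "magma_hom (free_quandle A) (free_qop A) X (\<rhd>) f" "s \<in> qterms A" for f s
    using that qclass_in_free_quandle unfolding magma_hom_def by blast
  have mul: "f (qclass A (QMul s t)) = f (qclass A s) \<rhd> f (qclass A t)"
    if "magma_hom (free_quandle A) (free_qop A) X (\<rhd>) f" "s \<in> qterms A" "t \<in> qterms A" for f s t
  proof -
    have "f (free_qop A (qclass A s) (qclass A t)) = f (qclass A s) \<rhd> f (qclass A t)"
      using that qclass_in_free_quandle unfolding magma_hom_def by blast
    then show ?thesis using that by (simp add: free_qop_class)
  qed
  have "h (qclass A t) = k (qclass A t)" if "t \<in> qterms A" for t
    using that
  proof (induction t)
    case (QGen a)
    then show ?case using gen by (simp add: free_gen_def)
  next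
    case (QMul s t)
    then show ?case using mul[OF h, of s t] mul[OF k, of s t] by simp
  next
    case (QDiv s t)
    have st: "s \<in> qterms A" "t \<in> qterms A" using QDiv.prems by auto
    then have eq: "qclass A (QMul (QDiv s t) t) = qclass A s"
      by (simp add: qclass_eq_iff qcong.div_mul)
    have "h (qclass A (QDiv s t)) \<rhd> h (qclass A t)
        = k (qclass A (QDiv s t)) \<rhd> h (qclass A t)"
      using mul[OF h, of "QDiv s t" t] mul[OF k, of "QDiv s t" t] QDiv st eq by simp
    then show ?case
      using bij_right[of "h (qclass A t)"] cl[OF h] cl[OF k] QDiv.prems st
      by (auto simp: bij_betw_def inj_on_def)
  qed
  then show ?thesis using P by (auto elim: free_quandleE)
qed

end


section \<open>Quandle rings\<close>

text \<open>
  Elements of the free \<open>\<int>\<close>-module on \<open>X\<close> are the finitely supported functions with support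
  in \<open>X\<close>.
\<close>

definition quandle_ring :: "'a set \<Rightarrow> ('a \<Rightarrow>\<^sub>0 int) set"
  where "quandle_ring X = {u. Poly_Mapping.keys u \<subseteq> X}"

definition qbasis :: "'a \<Rightarrow> ('a \<Rightarrow>\<^sub>0 int)"
  where "qbasis x = Poly_Mapping.single x 1"

definition qr_mult :: "('a \<Rightarrow> 'a \<Rightarrow> 'a) \<Rightarrow> ('a \<Rightarrow>\<^sub>0 int) \<Rightarrow> ('a \<Rightarrow>\<^sub>0 int) \<Rightarrow> ('a \<Rightarrow>\<^sub>0 int)"
  where "qr_mult f u v =
    (\<Sum>x\<in>Poly_Mapping.keys u. \<Sum>y\<in>Poly_Mapping.keys v.
       Poly_Mapping.single (f x y) (Poly_Mapping.lookup u x * Poly_Mapping.lookup v y))"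

definition qr_idempotent :: "'a set \<Rightarrow> ('a \<Rightarrow> 'a \<Rightarrow> 'a) \<Rightarrow> ('a \<Rightarrow>\<^sub>0 int) \<Rightarrow> bool"
  where "qr_idempotent X f u \<longleftrightarrow> u \<in> quandle_ring X \<and> u \<noteq> 0 \<and> qr_mult f u u = u"

lemma qr_mult_basis: "qr_mult f (qbasis x) (qbasis y) = qbasis (f x y)"
  by (simp add: qr_mult_def qbasis_def)

lemma qr_mult_superset:
  assumes "finite S" "finite T" "Poly_Mapping.keys u \<subseteq> S" "Poly_Mapping.keys v \<subseteq> T"
  shows "qr_mult f u v =
    (\<Sum>x\<in>S. \<Sum>y\<in>T.
       Poly_Mapping.single (f x y) (Poly_Mapping.lookup u x * Poly_Mapping.lookup v y))"
proof -
  have "(\<Sum>y\<in>Poly_Mapping.keys v.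
          Poly_Mapping.single (f x y) (Poly_Mapping.lookup u x * Poly_Mapping.lookup v y))
      = (\<Sum>y\<in>T.
          Poly_Mapping.single (f x y) (Poly_Mapping.lookup u x * Poly_Mapping.lookup v y))" for x
    using assms by (intro sum.mono_neutral_left) (auto simp: in_keys_iff)
  then show ?thesis
    unfolding qr_mult_def
    using assms by (auto intro!: sum.mono_neutral_left simp: in_keys_iff)
qed

lemma qr_mult_add_left: "qr_mult f (u + v) w = qr_mult f u w + qr_mult f v w"
proof -
  let ?S = "Poly_Mapping.keys u \<union> Poly_Mapping.keys v"
  have "Poly_Mapping.keys (u + v) \<subseteq> ?S" by (rule Poly_Mapping.keys_add)
  then show ?thesis
    by (simp add: qr_mult_superset[where S = ?S and T = "Poly_Mapping.keys w"]
        lookup_add distrib_right single_add sum.distrib)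
qed

lemma qr_mult_add_right: "qr_mult f w (u + v) = qr_mult f w u + qr_mult f w v"
proof -
  let ?S = "Poly_Mapping.keys u \<union> Poly_Mapping.keys v"
  have "Poly_Mapping.keys (u + v) \<subseteq> ?S" by (rule Poly_Mapping.keys_add)
  then show ?thesis
    by (simp add: qr_mult_superset[where T = ?S and S = "Poly_Mapping.keys w"]
        lookup_add distrib_left single_add sum.distrib)
qed

end

theory Submission imports Defs
begin

text \<open>
  The free quandle consists of the conjugates \<open>w\<^sup>-\<^sup>1 x\<^sub>i w\<close> of the generators of a free group, with
  conjugation as operation; the conjugate is determined by \<open>i\<close> and the reduced word \<open>w\<close>, normalised
  not to begin with \<open>x\<^sub>i\<close> or its inverse. Let \<open>m\<close> be the maximal length of \<open>w\<close> over the support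
  of an idempotent \<open>u\<close>, and let \<open>L\<close> be the maximal length of a product of two support elements.

  If \<open>x * y\<close> is longer than \<open>x\<close>, where \<open>y = v\<^sup>-\<^sup>1 x\<^sub>j v\<close>, then the word of \<open>x * y\<close> ends in \<open>x\<^sub>j v\<close>.
  Hence if \<open>L > m\<close> and two products \<open>x * y = x' * y'\<close> of length \<open>L\<close> coincide with \<open>y \<noteq> y'\<close>, then one
  of the words of \<open>y, y'\<close> is longer, say that of \<open>y\<close>, and \<open>x' * y\<close> turns out to be longer than \<open>L\<close>.
  So a product of length \<open>L\<close> arises only once, cannot cancel in \<open>u\<^sup>2\<close>, and therefore lies in
  the support, contradicting \<open>L > m\<close>. Thus \<open>L \<le> m\<close>; but \<open>x * y\<close> is longer than \<open>m\<close> whenever \<open>y\<close> has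
  length \<open>m\<close> and \<open>x \<noteq> y\<close>, so the support is a singleton.
\<close>

section \<open>Normal forms in the free quandle\<close>

type_synonym 'g letter = "'g \<times> bool"

definition linv :: "'g letter \<Rightarrow> 'g letter"
  where "linv a = (fst a, \<not> snd a)"

definition winv :: "'g letter list \<Rightarrow> 'g letter list"
  where "winv u = map linv (rev u)"

lemma linv_simps [simp]:
  "linv (linv a) = a" "fst (linv a) = fst a" "linv (j, s) = (j, \<not> s)"
  "linv a = linv b \<longleftrightarrow> a = b" "linv a \<noteq> a" "a \<noteq> linv a"
  by (auto simp: linv_def prod_eq_iff)

lemma winv_simps [simp]:
  "winv [] = []" "winv (a # u) = winv u @ [linv a]" "winv (u @ v) = winv v @ winv u"
  "winv (winv u) = u" "length (winv u) = length u" "fst ` set (winv u) = fst ` set u"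
  by (auto simp: winv_def rev_map image_image comp_def)

text \<open>
  Words are stored backwards: the head of the list is the last letter, on which the group acts
  from the right. The pair \<open>(i, w)\<close> with \<open>nf i w\<close> stands for the conjugate of the generator \<open>i\<close>
  by the group element \<open>w\<close>.
\<close>

fun nf :: "'g \<Rightarrow> 'g letter list \<Rightarrow> bool" where
  "nf i [] \<longleftrightarrow> True"
| "nf i [a] \<longleftrightarrow> fst a \<noteq> i"
| "nf i (a # b # w) \<longleftrightarrow> b \<noteq> linv a \<and> nf i (b # w)"

text \<open>Right multiplication by a letter on the coset \<open><x_i> w\<close>: the empty word
  absorbs \<open>x_i\<close> and its inverse, as they commute with \<open>x_i\<close>.\<close>

fun act :: "'g \<Rightarrow> 'g letter \<Rightarrow> 'g letter list \<Rightarrow> 'g letter list" where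
  "act i a [] = (if fst a = i then [] else [a])"
| "act i a (b # w) = (if b = linv a then w else a # b # w)"

definition gact :: "'g \<Rightarrow> 'g letter list \<Rightarrow> 'g letter list \<Rightarrow> 'g letter list"
  where "gact i u w = foldr (act i) u w"

fun conjw :: "'g \<times> 'g letter list \<Rightarrow> 'g letter list"
  where "conjw (j, v) = v @ (j, True) # winv v"

fun nf_op :: "'g \<times> 'g letter list \<Rightarrow> 'g \<times> 'g letter list \<Rightarrow> 'g \<times> 'g letter list"
  where "nf_op (i, w) y = (i, gact i (conjw y) w)"

definition nfs :: "'g set \<Rightarrow> ('g \<times> 'g letter list) set"
  where "nfs A = {(i, w). i \<in> A \<and> nf i w \<and> fst ` set w \<subseteq> A}"

section \<open>Reduction and the action of words\<close>

lemma gact_simps [simp]: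
  "gact i [] w = w" "gact i (a # u) w = act i a (gact i u w)"
  "gact i (u @ v) w = gact i u (gact i v w)"
  by (simp_all add: gact_def)

lemma nf_tl: "nf i (a # w) \<Longrightarrow> nf i w"
  by (cases w) auto

lemma nf_appendD: "nf i (v @ w) \<Longrightarrow> nf i w"
  by (induction v) (auto dest: nf_tl)

text \<open>A last entry of \<open>v\<close>, if any, does not involve \<open>j\<close>, so nothing
  cancels at the seam.\<close>

lemma nf_append: "nf j v \<Longrightarrow> nf i ((j, s) # w) \<Longrightarrow> nf i (v @ (j, s) # w)"
proof (induction v)
  case (Cons a v)
  then show ?case by (cases v) (auto simp: linv_def)
qed simp

lemma act_push: "nf i (a # w) \<Longrightarrow> act i a w = a # w"
  by (cases w) auto

lemma nf_act: "nf i w \<Longrightarrow> nf i (act i a w)"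
  by (cases w) (auto dest: nf_tl)

lemma act_linv: "nf i w \<Longrightarrow> act i (linv a) (act i a w) = w"
proof (cases w)
  case (Cons b v)
  then show "nf i w \<Longrightarrow> ?thesis" by (cases v) auto
qed auto

lemma act_linv': "nf i w \<Longrightarrow> act i a (act i (linv a) w) = w"
  using act_linv[of i w "linv a"] by simp

lemma nf_gact: "nf i w \<Longrightarrow> nf i (gact i u w)"
  by (induction u) (auto intro: nf_act)

lemma gact_winv: "nf i w \<Longrightarrow> gact i (winv u) (gact i u w) = w"
  by (induction u arbitrary: w) (auto simp: act_linv nf_gact)

lemma gact_winv': "nf i w \<Longrightarrow> gact i u (gact i (winv u) w) = w"
  using gact_winv[of i w "winv u"] by simp

lemma gact_push: "nf i (v @ w) \<Longrightarrow> gact i v w = v @ w"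
proof (induction v)
  case (Cons a v)
  then have "nf i (v @ w)" by (auto dest: nf_tl)
  with Cons show ?case by (simp add: act_push)
qed simp

lemma gact_pop: "gact i (winv v) (v @ w) = w"
  by (induction v) auto

lemma length_act: "length (act i a w) \<le> Suc (length w)"
  by (cases w) auto

lemma length_gact: "length (gact i u w) \<le> length u + length w"
  by (induction u) (auto intro: order_trans[OF length_act])

lemma set_act: "fst ` set (act i a w) \<subseteq> insert (fst a) (fst ` set w)"
  by (cases w) auto

lemma set_gact: "fst ` set (gact i u w) \<subseteq> fst ` set u \<union> fst ` set w"
proof (induction u)
  case (Cons a u)
  then show ?case
    using set_act[of i a "gact i u w"] unfolding gact_simps list.set image_insert by blast
qed simp

text \<open>Moving \<open>y = (j, v)\<close> by \<open>a\<close> turns its group element into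
  \<open>a^-1 y a\<close>. If \<open>a\<close> is absorbed, this holds because \<open>x_j\<close>
  commutes with its own powers.\<close>

lemma gact_conjw_act:
  assumes "nf i w" "nf j v"
  shows "gact i (conjw (j, act j a v)) w = act i a (gact i (conjw (j, v)) (act i (linv a) w))"
proof (cases v)
  case Nil
  have "act i a (act i (j, True) (act i (linv a) w)) = act i (j, True) w" if "fst a = j"
  proof (cases "snd a")
    case True
    then have "a = (j, True)" using that by (simp add: prod_eq_iff)
    then show ?thesis using act_linv'[OF assms(1), of "(j, True)"] by simp
  next
    case False
    then have "a = linv (j, True)" using that by (simp add: prod_eq_iff)
    then show ?thesis using act_linv[OF nf_act[OF assms(1)], of "(j, True)"] by simp
  qed
  with Nil show ?thesis by simp
next
  case (Cons b v')
  show ?thesis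
  proof (cases "b = linv a")
    case True
    then show ?thesis using Cons assms
      by (simp add: act_linv' nf_gact nf_act)
  qed (use Cons in simp)
qed

text \<open>With \<open>u = conjw z\<close> this yields self-distributivity of
  \<open>nf_op\<close>.\<close>

lemma gact_conjw_gact:
  assumes "nf j v" "nf i w"
  shows "gact i (conjw (j, gact j u v)) w
    = gact i u (gact i (conjw (j, v)) (gact i (winv u) w))"
  using assms(2)
proof (induction u arbitrary: w)
  case (Cons a u)
  then show ?case
    using gact_conjw_act[of i w j "gact j u v" a] assms(1)
    by (simp add: nf_gact nf_act del: conjw.simps)
qed simp

lemma conjw_self: "nf j v \<Longrightarrow> gact j (conjw (j, v)) v = v"
  using gact_pop[of j v "[]"] gact_push[of j v "[]"] by simp

section \<open>The quandle of normal forms\<close>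

lemma nfs_act: "(i, w) \<in> nfs A \<Longrightarrow> fst ` set u \<subseteq> A \<Longrightarrow> (i, gact i u w) \<in> nfs A"
  using order_trans[OF set_gact[of i u w], of A] by (simp add: nfs_def nf_gact)

lemma set_conjw: "y \<in> nfs A \<Longrightarrow> fst ` set (conjw y) \<subseteq> A"
  by (cases y) (auto simp: nfs_def image_Un)

lemma quandle_nfs:
  assumes "A \<noteq> {}"
  shows "quandle (nfs A) nf_op"
proof
  obtain a where "a \<in> A" using assms by blast
  then have "(a, []) \<in> nfs A" by (simp add: nfs_def)
  then show "nfs A \<noteq> {}" by blast
next
  fix x y assume "x \<in> nfs A" "y \<in> nfs A"
  then show "nf_op x y \<in> nfs A"
    by (cases x) (simp add: nfs_act set_conjw)
next
  fix y assume "y \<in> nfs A"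
  then show "nf_op y y = y"
    by (cases y) (auto simp: nfs_def conjw_self simp del: conjw.simps)
next
  fix z assume z: "z \<in> nfs A"
  then have set: "fst ` set (conjw z) \<subseteq> A" by (rule set_conjw)
  let ?f = "\<lambda>x. nf_op x z" and ?g = "\<lambda>(i, w). (i, gact i (winv (conjw z)) w)"
  have bij: "bij_betw ?f (nfs A) (nfs A)"
  proof (rule bij_betw_byWitness[where f' = ?g])
    show "\<forall>x\<in>nfs A. ?g (?f x) = x" "\<forall>x\<in>nfs A. ?f (?g x) = x"
      by (auto simp: nfs_def gact_winv gact_winv')
    show "?f ` nfs A \<subseteq> nfs A" "?g ` nfs A \<subseteq> nfs A"
      using set by (auto simp: nfs_act)
  qed
  have distrib: "nf_op (nf_op x y) z = nf_op (nf_op x z) (nf_op y z)"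
    if "x \<in> nfs A" "y \<in> nfs A" for x y
  proof -
    obtain i w j v where eq: "x = (i, w)" "y = (j, v)" by (cases x; cases y)
    then have "nf i w" "nf j v" using that by (auto simp: nfs_def)
    then show ?thesis
      unfolding eq nf_op.simps by (simp only: gact_conjw_gact gact_winv nf_gact)
  qed
  have "?f \<in> nfs A \<rightarrow> nfs A"
    using set by (auto simp: nfs_act)
  with bij show "magma_aut (nfs A) nf_op ?f"
    unfolding magma_aut_def magma_hom_def by (intro conjI ballI distrib)
qed

section \<open>Evaluation of normal forms in an arbitrary quandle\<close>

context quandle begin

fun qstep :: "('g \<Rightarrow> 'a) \<Rightarrow> 'g letter \<Rightarrow> 'a \<Rightarrow> 'a" where
  "qstep \<phi> (j, True) x = x \<rhd> \<phi> j"
| "qstep \<phi> (j, False) x = inv_into X (\<lambda>z. z \<rhd> \<phi> j) x"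

text \<open>In the free quandle this becomes a left inverse of the map to normal forms; letters act
  as right translations or their inverses.\<close>

definition of_nf :: "('g \<Rightarrow> 'a) \<Rightarrow> 'g \<times> 'g letter list \<Rightarrow> 'a"
  where "of_nf \<phi> y = foldr (qstep \<phi>) (snd y) (\<phi> (fst y))"

lemma qstep_closed: "\<lbrakk>\<phi> (fst a) \<in> X; x \<in> X\<rbrakk> \<Longrightarrow> qstep \<phi> a x \<in> X"
  by (cases a; cases "snd a") (auto simp: closed rdiv_closed)

lemma qsteps_closed:
  "\<lbrakk>\<phi> \<in> A \<rightarrow> X; fst ` set u \<subseteq> A; x \<in> X\<rbrakk> \<Longrightarrow> foldr (qstep \<phi>) u x \<in> X"
  by (induction u) (auto intro!: qstep_closed)

lemma qstep_linv: "\<lbrakk>\<phi> (fst a) \<in> X; x \<in> X\<rbrakk> \<Longrightarrow> qstep \<phi> a (qstep \<phi> (linv a) x) = x"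
  by (cases a; cases "snd a") (auto simp: mult_rdiv rdiv_mult)

lemma qstep_mult:
  assumes "\<phi> (fst a) \<in> X" "x \<in> X" "y \<in> X"
  shows "qstep \<phi> a (x \<rhd> y) = qstep \<phi> a x \<rhd> qstep \<phi> a y"
proof (cases "snd a")
  case True
  then show ?thesis using assms by (cases a) (simp add: rdistrib)
next
  case False
  then obtain j where a: "a = (j, False)" by (cases a) auto
  let ?d = "inv_into X (\<lambda>z. z \<rhd> \<phi> j)"
  have j: "\<phi> j \<in> X" using assms a by simp
  have "(?d x \<rhd> ?d y) \<rhd> \<phi> j = x \<rhd> y"
    using assms j by (simp add: rdistrib rdiv_closed rdiv_mult)
  then have "?d (x \<rhd> y) = ?d x \<rhd> ?d y"
    using mult_rdiv[of "?d x \<rhd> ?d y" "\<phi> j"] assms j by (simp add: closed rdiv_closed)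
  then show ?thesis using a by simp
qed

lemma qstep_self: "\<phi> i \<in> X \<Longrightarrow> qstep \<phi> (i, s) (\<phi> i) = \<phi> i"
  using mult_rdiv[of "\<phi> i" "\<phi> i"] by (cases s) (simp_all add: idem)

lemma of_nf_closed: "\<lbrakk>\<phi> \<in> A \<rightarrow> X; y \<in> nfs A\<rbrakk> \<Longrightarrow> of_nf \<phi> y \<in> X"
  by (cases y) (simp add: of_nf_def nfs_def qsteps_closed[of _ A] Pi_iff)

lemma of_nf_act:
  assumes "\<phi> \<in> A \<rightarrow> X" "(i, w) \<in> nfs A" "fst a \<in> A"
  shows "of_nf \<phi> (i, act i a w) = qstep \<phi> a (of_nf \<phi> (i, w))"
proof (cases w)
  \<comment> \<open>If \<open>act\<close> absorbs \<open>a\<close>, idempotency says that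
    translating the generator by itself fixes it.\<close>
  case Nil
  then show ?thesis
    using assms qstep_self[of \<phi> i "snd a"] by (auto simp: of_nf_def nfs_def Pi_iff)
next
  case (Cons b v)
  have "foldr (qstep \<phi>) v (\<phi> i) \<in> X"
    using assms Cons by (simp add: nfs_def qsteps_closed[of _ A] Pi_iff)
  then show ?thesis
    using assms Cons by (auto simp: of_nf_def qstep_linv Pi_iff)
qed

lemma of_nf_gact:
  assumes "\<phi> \<in> A \<rightarrow> X" "(i, w) \<in> nfs A" "fst ` set u \<subseteq> A"
  shows "of_nf \<phi> (i, gact i u w) = foldr (qstep \<phi>) u (of_nf \<phi> (i, w))"
  using assms(3)
  by (induction u) (simp_all add: of_nf_act[OF assms(1)] nfs_act[OF assms(2)])

text \<open>A step \<open>S\<close> is an automorphism, so translation by \<open>S y\<close> is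
  \<open>S^-1\<close>, then translation by \<open>y\<close>, then \<open>S\<close>.\<close>

lemma qsteps_conjw:
  assumes "\<phi> \<in> A \<rightarrow> X" "j \<in> A" "fst ` set v \<subseteq> A" "x \<in> X"
  shows "foldr (qstep \<phi>) (conjw (j, v)) x = x \<rhd> of_nf \<phi> (j, v)"
  using assms(3,4)
proof (induction v arbitrary: x)
  case Nil
  then show ?case by (simp add: of_nf_def)
next
  case (Cons a v)
  have a: "\<phi> (fst a) \<in> X" using Cons assms by auto
  let ?y = "foldr (qstep \<phi>) v (\<phi> j)"
  have y: "?y \<in> X" using Cons assms by (simp add: qsteps_closed[of _ A] Pi_iff)
  have x: "qstep \<phi> (linv a) x \<in> X" using a Cons by (simp add: qstep_closed)
  have "foldr (qstep \<phi>) (conjw (j, a # v)) x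
      = qstep \<phi> a (foldr (qstep \<phi>) (conjw (j, v)) (qstep \<phi> (linv a) x))"
    by simp
  also have "\<dots> = qstep \<phi> a (qstep \<phi> (linv a) x \<rhd> ?y)"
    using Cons x by (simp add: of_nf_def del: conjw.simps)
  also have "\<dots> = x \<rhd> qstep \<phi> a ?y"
    using a x y Cons.prems by (simp add: qstep_mult qstep_linv)
  finally show ?case by (simp add: of_nf_def)
qed

lemma magma_hom_of_nf:
  assumes "\<phi> \<in> A \<rightarrow> X"
  shows "magma_hom (nfs A) nf_op X (\<rhd>) (of_nf \<phi>)"
  unfolding magma_hom_def
proof (intro conjI ballI)
  fix x y assume xy: "x \<in> nfs A" "y \<in> nfs A"
  obtain i w j v where eq: "x = (i, w)" "y = (j, v)" by (cases x; cases y)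
  show "of_nf \<phi> (nf_op x y) = of_nf \<phi> x \<rhd> of_nf \<phi> y"
  proof -
    have "j \<in> A" "fst ` set v \<subseteq> A" using xy eq by (simp_all add: nfs_def)
    from qsteps_conjw[OF assms this of_nf_closed[OF assms xy(1)]]
      of_nf_gact[OF assms xy(1)[unfolded eq] set_conjw[OF xy(2)]]
    show ?thesis by (simp only: eq nf_op.simps)
  qed
next
  show "of_nf \<phi> \<in> nfs A \<rightarrow> X"
    by (rule Pi_I) (rule of_nf_closed[OF assms])
qed

end

text \<open>The universal map \<open>h\<close> followed by \<open>of_nf\<close> fixes the
  generators, hence is the identity by uniqueness.\<close>

lemma free_quandle_embeds_nfs:
  assumes "A \<noteq> {}"
  obtains h where "magma_hom (free_quandle A) (free_qop A) (nfs A) nf_op h"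
    and "inj_on h (free_quandle A)"
proof -
  interpret N: quandle "nfs A" nf_op by (rule quandle_nfs[OF assms])
  interpret F: quandle "free_quandle A" "free_qop A" by (rule quandle_free_quandle[OF assms])
  have "(\<lambda>a. (a, [])) \<in> A \<rightarrow> nfs A" by (auto simp: nfs_def)
  then obtain h where h: "magma_hom (free_quandle A) (free_qop A) (nfs A) nf_op h"
    and hg: "\<forall>a\<in>A. h (free_gen A a) = (a, [])"
    using N.free_quandle_universal by blast
  have gen: "free_gen A \<in> A \<rightarrow> free_quandle A"
    by (simp add: free_gen_def qclass_in_free_quandle)
  let ?c = "F.of_nf (free_gen A)"
  have c: "magma_hom (nfs A) nf_op (free_quandle A) (free_qop A) ?c"
    by (rule F.magma_hom_of_nf[OF gen])
  have "magma_hom (free_quandle A) (free_qop A) (free_quandle A) (free_qop A) (?c \<circ> h)"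
    using c h by (fastforce simp: magma_hom_def Pi_iff)
  moreover have "magma_hom (free_quandle A) (free_qop A) (free_quandle A) (free_qop A) id"
    by (simp add: magma_hom_def)
  moreover have "\<forall>a\<in>A. (?c \<circ> h) (free_gen A a) = id (free_gen A a)"
    using hg by (simp add: F.of_nf_def)
  ultimately have "(?c \<circ> h) P = id P" if "P \<in> free_quandle A" for P
    using F.free_quandle_universal_unique that by blast
  then have "inj_on h (free_quandle A)"
    by (intro inj_on_inverseI[where g = ?c]) simp
  with h that show thesis by blast
qed


section \<open>Lengths of products\<close>

text \<open>After \<open>v^-1\<close> has acted, \<open>x_j\<close> can only be lost by cancelling
  its inverse or by being absorbed; the last two hypotheses exclude this. Induction strips a letter
  off \<open>v\<close> and lets its inverse act on \<open>w\<close>.\<close>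

lemma nf_op_pushes:
  assumes "nf i w" "nf j v" "\<And>w'. w \<noteq> v @ (j, False) # w'" "(i, w) \<noteq> (j, v)"
  shows "\<exists>p. nf_op (i, w) (j, v) = (i, v @ (j, True) # p)"
  using assms
proof (induction v arbitrary: w)
  case Nil
  then show ?case by (cases w) auto
next
  case (Cons a v)
  let ?w = "act i (linv a) w"
  have w: "act i a ?w = w" using Cons.prems by (simp add: act_linv')
  have nfw: "nf i ?w" using Cons.prems by (simp add: nf_act)
  have nfv: "nf j v" using Cons.prems by (auto dest: nf_tl)
  have 1: "?w \<noteq> v @ (j, False) # w'" for w'
  proof
    assume eq: "?w = v @ (j, False) # w'"
    have "nf i ((a # v) @ (j, False) # w')"
      using nf_append[OF Cons.prems(2)] nfw eq nf_appendD by metis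
    then have "w = (a # v) @ (j, False) # w'" using w eq by (simp add: act_push)
    then show False using Cons.prems(3) by blast
  qed
  have 2: "(i, ?w) \<noteq> (j, v)"
    using w Cons.prems act_push by fastforce
  obtain p where p: "gact i (conjw (j, v)) ?w = v @ (j, True) # p"
    using Cons.IH[OF nfw nfv 1 2] by auto
  then have "nf i (v @ (j, True) # p)" using nf_gact[OF nfw] by metis
  then have "nf i ((a # v) @ (j, True) # p)"
    using nf_append[OF Cons.prems(2)] nf_appendD by metis
  then have "act i a (v @ (j, True) # p) = a # v @ (j, True) # p" by (simp add: act_push)
  then show ?case using p by simp
qed

text \<open>In the two cases excluded by \<open>nf_op_pushes\<close> the word does not grow:
  \<open>x_j\<close> cancels its inverse, or \<open>x * x = x\<close>.\<close>

lemma nf_op_longer: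
  assumes "nf i w" "nf j v" "length (snd (nf_op (i, w) (j, v))) > length w"
  shows "\<exists>p. nf_op (i, w) (j, v) = (i, v @ (j, True) # p)"
proof (rule nf_op_pushes[OF assms(1,2)])
  fix w'
  show "w \<noteq> v @ (j, False) # w'"
  proof
    assume eq: "w = v @ (j, False) # w'"
    then have "gact i (conjw (j, v)) w = gact i v w'" by (simp add: gact_pop)
    then show False using assms(3) eq length_gact[of i v w'] by simp
  qed
  show "(i, w) \<noteq> (j, v)"
    using assms conjw_self by fastforce
qed

text \<open>For non-empty \<open>q\<close>, the first letter to act is pushed. As \<open>q\<close>
  is reduced, so are all later ones, and the last does not involve \<open>j\<close>.\<close>

lemma gact_winv_hd:
  assumes "y \<noteq> []" "nf j q" "q = [] \<Longrightarrow> fst (hd y) \<noteq> j" "q \<noteq> [] \<Longrightarrow> hd y \<noteq> hd q"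
  shows "gact i (winv q) y \<noteq> [] \<and> fst (hd (gact i (winv q) y)) \<noteq> j
    \<and> length y \<le> length (gact i (winv q) y)"
  using assms
proof (induction q arbitrary: y)
  case (Cons a q)
  have y: "act i (linv a) y = linv a # y"
    using Cons.prems by (cases y) auto
  have 1: "fst (hd (linv a # y)) \<noteq> j" if "q = []"
    using that Cons.prems by simp
  have 2: "hd (linv a # y) \<noteq> hd q" if "q \<noteq> []"
    using that Cons.prems by (cases q) auto
  have "nf j q" using Cons.prems(2) by (rule nf_tl)
  from Cons.IH[OF _ this 1 2] show ?case by (auto simp: y)
qed simp

text \<open>
  The word computed here is \<open>p x\<^sub>j q x\<^sub>k\<^sup>-\<^sup>1 q\<^sup>-\<^sup>1\<close> (read backwards). Only powers of \<open>x\<^sub>k\<close> at the end of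
  \<open>q\<close> can cancel, and they commute with \<open>x\<^sub>k\<^sup>-\<^sup>1\<close>.
\<close>

lemma gact_winv_middle:
  assumes "nf j ((k, True) # q)"
  shows "let r = gact i (winv q) (act i (k, False) (q @ (j, True) # p))
    in r \<noteq> [] \<and> fst (hd r) \<noteq> j \<and> length p < length r"
  using assms
proof (induction q)
  case Nil
  then show ?case by simp
next
  case (Cons a q)
  show ?case
  proof (cases "a = (k, True)")
    case True
    with Cons show ?thesis by simp
  next
    case False
    have "a \<noteq> (k, False)" using Cons.prems by auto
    then have "gact i (winv (a # q)) ((k, False) # (a # q) @ (j, True) # p) \<noteq> []
      \<and> fst (hd (gact i (winv (a # q)) ((k, False) # (a # q) @ (j, True) # p))) \<noteq> j
      \<and> length ((k, False) # (a # q) @ (j, True) # p)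
        \<le> length (gact i (winv (a # q)) ((k, False) # (a # q) @ (j, True) # p))"
      using Cons.prems by (intro gact_winv_hd) (auto dest: nf_tl)
    then show ?thesis using False by (simp add: Let_def del: winv_simps)
  qed
qed

text \<open>Undoing the product with \<open>(k, v')\<close> deletes this \<open>x_k\<close> from
  \<open>z\<close>. Acting by \<open>v^-1\<close> then leaves \<open>r\<close>, which is longer than
  \<open>p\<close> and does not have \<open>j\<close> at its head. So \<open>x_j\<close> and
  \<open>v\<close> are pushed onto \<open>r\<close> without cancellation.\<close>

lemma nf_op_cross_longer:
  assumes "nf i z" "nf j v" "nf i w" "nf_op (i, w) (k, v') = (i, z)"
    and z: "z = v @ (j, True) # p" and v: "v = v' @ (k, True) # q"
  shows "length z < length (snd (nf_op (i, w) (j, v)))"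
proof -
  have "w = gact i (winv (conjw (k, v'))) z"
    using assms gact_winv[of i w "conjw (k, v')"] by auto
  also have "\<dots> = gact i v' (q @ (j, True) # p)"
    by (simp add: z v gact_pop)
  finally have w: "w = gact i v' (q @ (j, True) # p)" .
  have "nf i (v' @ (k, True) # q @ (j, True) # p)" using assms(1) z v by simp
  then have nfq: "nf i (q @ (j, True) # p)" by (metis nf_appendD nf_tl)
  have nfk: "nf j ((k, True) # q)" using assms(2) v by (metis nf_appendD)
  define r where "r = gact i (winv q) (act i (k, False) (q @ (j, True) # p))"
  have r: "r \<noteq> []" "fst (hd r) \<noteq> j" "length p < length r"
    using gact_winv_middle[OF nfk, of i p] by (auto simp: r_def Let_def)
  have wr: "gact i (winv v) w = r"
    by (simp add: v w r_def gact_winv nfq)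
  have "nf i r" by (simp add: r_def nfq nf_gact nf_act)
  then have nfr: "nf i ((j, True) # r)" using r by (cases r) auto
  have "gact i (conjw (j, v)) w = gact i v ((j, True) # r)"
    using wr nfr by (simp add: act_push)
  also have "\<dots> = v @ (j, True) # r"
    by (intro gact_push nf_append assms(2) nfr)
  finally show ?thesis using z r by simp
qed

lemma longest_product_unique:
  assumes nf: "\<And>i w. (i, w) \<in> S \<Longrightarrow> nf i w"
    and xy: "x \<in> S" "y \<in> S" "x' \<in> S" "y' \<in> S" "nf_op x y = nf_op x' y'"
    and longer: "\<And>s. s \<in> S \<Longrightarrow> length (snd s) < length (snd (nf_op x y))"
    and max: "\<And>s t. s \<in> S \<Longrightarrow> t \<in> S \<Longrightarrow> length (snd (nf_op s t)) \<le> length (snd (nf_op x y))"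
  shows "y = y'"
proof -
  obtain i w j v i' w' k v'
    where eq: "x = (i, w)" "y = (j, v)" "x' = (i', w')" "y' = (k, v')"
    by (cases x; cases y; cases x'; cases y')
  obtain z where z: "nf_op x y = (i, z)" by (simp add: eq)
  have i': "i' = i" using xy(5) eq by simp
  have nfz: "nf i z" using z nf[of i w] xy(1) eq by (auto simp: nf_gact nf_act)
  note nfs = nf[OF xy(1)[unfolded eq]] nf[OF xy(2)[unfolded eq]]
    nf[OF xy(3)[unfolded eq i']] nf[OF xy(4)[unfolded eq]]
  obtain p where p: "z = v @ (j, True) # p"
    using nf_op_longer[of i w j v] nfs longer[OF xy(1)] z eq by auto
  obtain p' where p': "z = v' @ (k, True) # p'"
    using nf_op_longer[of i w' k v'] nfs longer[OF xy(3)] z xy(5) eq i' by auto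
  consider "length v = length v'" | "length v' < length v" | "length v < length v'" by linarith
  then show ?thesis
  proof cases
    case 1
    then show ?thesis using p p' eq by simp
  next
    case 2
    \<comment> \<open>Both words are initial segments of the list \<open>z\<close>, so the shorter
      one followed by its generator starts the longer one.\<close>
    then obtain q where q: "v = v' @ (k, True) # q"
      using p p' by (auto simp: append_eq_append_conv2 append_eq_Cons_conv Cons_eq_append_conv)
    have "nf_op (i, w') (k, v') = (i, z)" using z xy(5) eq i' by metis
    from nf_op_cross_longer[OF nfz nfs(2,3) this p q] max[OF xy(3,2)]
    show ?thesis using z by (simp only: eq i' snd_conv)
  next
    case 3
    then obtain q where q: "v' = v @ (j, True) # q"
      using p p' by (auto simp: append_eq_append_conv2 append_eq_Cons_conv Cons_eq_append_conv)
    have "nf_op (i, w) (j, v) = (i, z)" using z eq by metis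
    from nf_op_cross_longer[OF nfz nfs(4,1) this p' q] max[OF xy(1,4)]
    show ?thesis using z by (simp only: eq snd_conv)
  qed
qed

text \<open>Here \<open>w\<close> is too short to contain \<open>v\<close> followed by an inverse of
  \<open>x_j\<close>.\<close>

lemma nf_op_longer_than_right:
  assumes "nf i w" "nf j v" "length w \<le> length v" "(i, w) \<noteq> (j, v)"
  shows "length v < length (snd (nf_op (i, w) (j, v)))"
proof -
  have "w \<noteq> v @ (j, False) # w'" for w' using assms(3) by auto
  then obtain p where "nf_op (i, w) (j, v) = (i, v @ (j, True) # p)"
    using nf_op_pushes[OF assms(1,2) _ assms(4)] by blast
  then show ?thesis by simp
qed


section \<open>Idempotents\<close>

lemma lookup_qr_mult:
  "Poly_Mapping.lookup (qr_mult f u v) z =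
    (\<Sum>(x, y) \<in> {(x, y). x \<in> Poly_Mapping.keys u \<and> y \<in> Poly_Mapping.keys v \<and> f x y = z}.
       Poly_Mapping.lookup u x * Poly_Mapping.lookup v y)"
proof -
  have "Poly_Mapping.lookup (qr_mult f u v) z =
    (\<Sum>(x, y) \<in> Poly_Mapping.keys u \<times> Poly_Mapping.keys v.
       if f x y = z then Poly_Mapping.lookup u x * Poly_Mapping.lookup v y else 0)"
    by (simp add: qr_mult_def lookup_sum lookup_single when_def sum.cartesian_product
        case_prod_unfold)
  also have "\<dots> = (\<Sum>(x, y) \<in> {(x, y). x \<in> Poly_Mapping.keys u \<and> y \<in> Poly_Mapping.keys v
      \<and> f x y = z}. Poly_Mapping.lookup u x * Poly_Mapping.lookup v y)"
    by (rule sum.mono_neutral_cong_right) (auto split: if_splits)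
  finally show ?thesis .
qed

text \<open>The coefficient is a single product of two non-zero integers.\<close>

lemma unique_product_in_keys:
  assumes "x \<in> Poly_Mapping.keys u" "y \<in> Poly_Mapping.keys v"
    and "\<And>x' y'. \<lbrakk>x' \<in> Poly_Mapping.keys u; y' \<in> Poly_Mapping.keys v; f x' y' = f x y\<rbrakk>
      \<Longrightarrow> x' = x \<and> y' = y"
  shows "f x y \<in> Poly_Mapping.keys (qr_mult f u v)"
proof -
  have "{(x', y'). x' \<in> Poly_Mapping.keys u \<and> y' \<in> Poly_Mapping.keys v \<and> f x' y' = f x y}
    = {(x, y)}"
    using assms by auto
  then show ?thesis using assms(1,2) by (simp add: in_keys_iff lookup_qr_mult)
qed

theorem theorem5p3:
  fixes n :: nat and u :: "nat qterm set \<Rightarrow>\<^sub>0 int"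
  assumes "n \<ge> 1"
    and "qr_idempotent (FQ n) (FQ_op n) u"
  shows "\<exists>x \<in> FQ n. u = qbasis x"
proof -
  have ne: "{..<n} \<noteq> {}" using assms(1) by (simp add: lessThan_empty_iff)
  interpret quandle "FQ n" "FQ_op n"
    unfolding FQ_def FQ_op_def by (rule quandle_free_quandle[OF ne])
  obtain h where hom: "magma_hom (FQ n) (FQ_op n) (nfs {..<n}) nf_op h"
    and inj: "inj_on h (FQ n)"
    using free_quandle_embeds_nfs[OF ne] unfolding FQ_def FQ_op_def by blast
  define K where "K = Poly_Mapping.keys u"
  have K: "K \<subseteq> FQ n" "finite K" "K \<noteq> {}" and sq: "qr_mult (FQ_op n) u u = u"
    using assms(2) by (auto simp: qr_idempotent_def quandle_ring_def K_def)
  define len where "len x = length (snd (h x))" for x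
  have h_op: "h (FQ_op n x y) = nf_op (h x) (h y)" if "x \<in> K" "y \<in> K" for x y
    using hom that K by (auto simp: magma_hom_def)
  have h_nf: "nf i w" if "(i, w) \<in> h ` K" for i w
    using hom that K by (fastforce simp: magma_hom_def nfs_def Pi_iff)
  define m where "m = Max (len ` K)"
  have m: "len x \<le> m" if "x \<in> K" for x
    using that K by (simp add: m_def)
  \<comment> \<open>All products of support elements count, even those that might cancel in
    \<open>u^2\<close>.\<close>
  define L where "L = Max ((\<lambda>(x, y). len (FQ_op n x y)) ` (K \<times> K))"
  have L: "len (FQ_op n x y) \<le> L" if "x \<in> K" "y \<in> K" for x y
    unfolding L_def using that K by (intro Max_ge) auto
  have "L \<in> (\<lambda>(x, y). len (FQ_op n x y)) ` (K \<times> K)"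
    unfolding L_def using K by (intro Max_in) auto
  then obtain x y where xy: "x \<in> K" "y \<in> K" "len (FQ_op n x y) = L" by auto
  have "L \<le> m"
  proof (rule ccontr)
    assume *: "\<not> L \<le> m"
    have "x' = x \<and> y' = y" if x'y': "x' \<in> K" "y' \<in> K" "FQ_op n x' y' = FQ_op n x y" for x' y'
    proof -
      have lenxy: "length (snd (nf_op (h x) (h y))) = L"
        using xy h_op by (simp add: len_def)
      have "h y = h y'"
      proof (rule longest_product_unique[of "h ` K" "h x" "h y" "h x'" "h y'"])
        show "nf_op (h x) (h y) = nf_op (h x') (h y')"
          using x'y' xy h_op by metis
        show "length (snd s) < length (snd (nf_op (h x) (h y)))" if "s \<in> h ` K" for s
          using that m * by (fastforce simp: lenxy len_def)
        show "length (snd (nf_op s t)) \<le> length (snd (nf_op (h x) (h y)))"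
          if "s \<in> h ` K" "t \<in> h ` K" for s t
          using that L by (auto simp: lenxy len_def h_op)
      qed (use xy x'y' h_nf in auto)
      then have "y = y'" using inj xy x'y' K by (auto simp: inj_on_def)
      \<comment> \<open>Right translations are injective, so equal right factors force equal left
        factors.\<close>
      moreover have "inj_on (\<lambda>s. FQ_op n s y) (FQ n)"
        using bij_right[of y] xy K by (auto simp: bij_betw_def)
      then have "x = x'"
        by (rule inj_onD) (use xy x'y' K \<open>y = y'\<close> in auto)
      ultimately show ?thesis by simp
    qed
    then have "FQ_op n x y \<in> K"
      using unique_product_in_keys[of x u y u "FQ_op n"] xy sq by (auto simp: K_def)
    then show False using m xy * by fastforce
  qed
  have "m \<in> len ` K" unfolding m_def using K by (intro Max_in) auto
  then obtain b where b: "b \<in> K" "len b = m" by auto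
  have "a = b" if "a \<in> K" for a
  proof (rule ccontr)
    assume "a \<noteq> b"
    then have ne: "h a \<noteq> h b" using inj that b K by (auto simp: inj_on_def)
    have "nf (fst (h a)) (snd (h a))" "nf (fst (h b)) (snd (h b))"
      using h_nf that b by auto
    then have "m < len (FQ_op n a b)"
      using nf_op_longer_than_right[of "fst (h a)" "snd (h a)" "fst (h b)" "snd (h b)"]
        ne m[OF that] b h_op[OF that b(1)] by (simp add: len_def)
    then show False using L[OF that b(1)] \<open>L \<le> m\<close> by simp
  qed
  then have K_eq: "Poly_Mapping.keys u = {b}" using b(1) unfolding K_def by blast
  define c where "c = Poly_Mapping.lookup u b"
  have u: "u = Poly_Mapping.single b c"
    using K_eq by (intro poly_mapping_eqI)
      (auto simp: c_def lookup_single when_def not_in_keys_iff_lookup_eq_zero[symmetric])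
  have "c \<noteq> 0" using K_eq by (simp add: c_def in_keys_iff[symmetric])
  have "FQ_op n b b = b" using b K idem by auto
  \<comment> \<open>Compare the coefficients of \<open>b\<close> in \<open>u^2 = u\<close>; as
    \<open>c\<close> is non-zero, it must be 1.\<close>
  then have "c * c = c"
    using arg_cong[OF sq, of "\<lambda>v. Poly_Mapping.lookup v b"]
    by (simp add: qr_mult_def K_eq c_def)
  then have "u = qbasis b" using \<open>c \<noteq> 0\<close> u by (simp add: qbasis_def)
  then show ?thesis using b K by auto
qed

end
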